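(* Let $S$ be an $\aleph_0$-categorical semigroup. Then every principal factor of $S$ is $\aleph_0$-categorical, and each principal factor of $S$ is either completely $0$-simple, completely simple, or null. Moreover, $S$ has only finitely many principal factors up to isomorphism.
   Context: All semigroups are countable (finite or countably infinite). For a semigroup $S$ and $n\ge 1$, $\operatorname{Aut}(S)$ acts on $S^n$ coordinatewise. A countable semigroup $S$ is $\aleph_0$-categorical if for every $n\geq 1$ this action of $\operatorname{Aut}(S)$ on $S^n$ has only finitely many orbits (by the Ryll-Nardzewski theorem this is equivalent to $S$ being determined up to isomorphism among countable structures by its first-order theory). For $a\in S$ let $J(a)=S^1aS^1$ be the principal two-sided ideal generated by $a$, $J_a$ the $\mathcal{J}$-class of $a$, and $I(a)=J(a)\setminus J_a$. The principal factors of $S$ are the Rees quotients $J(a)/I(a)$ for those $a$ with $I(a)\neq\emptyset$, together with the kernel (minimum ideal) of $S$ if it exists. A semigroup with zero is null if all products equal $0$. *)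

theory Defs
  imports "HOL-Algebra.Group_Action" "HOL-Library.Countable_Set"
begin

text \<open>
  A semigroup is represented by a HOL-Algebra \<^typ>\<open>'a monoid\<close> record of which only the carrier and
  the multiplication are used; the field \<^const>\<open>one\<close> carries no meaning.  The library notions
  \<^const>\<open>hom\<close>, \<^const>\<open>iso\<close>, \<^const>\<open>is_iso\<close> and \<^const>\<open>auto\<close> do not refer to that field either, so
  for such records they are the semigroup notions.
\<close>

definition is_semigroup :: "('a, 'b) monoid_scheme \<Rightarrow> bool" where
  "is_semigroup S \<longleftrightarrow>
     carrier S \<noteq> {} \<and>
     (\<forall>x\<in>carrier S. \<forall>y\<in>carrier S. x \<otimes>\<^bsub>S\<^esub> y \<in> carrier S) \<and>
     (\<forall>x\<in>carrier S. \<forall>y\<in>carrier S. \<forall>z\<in>carrier S.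
        (x \<otimes>\<^bsub>S\<^esub> y) \<otimes>\<^bsub>S\<^esub> z = x \<otimes>\<^bsub>S\<^esub> (y \<otimes>\<^bsub>S\<^esub> z))"

text \<open>The set \<open>S\<^sup>n\<close> is the set of lists of length \<open>n\<close> over the carrier.\<close>

definition aleph0_categorical :: "('a, 'b) monoid_scheme \<Rightarrow> bool" where
  "aleph0_categorical S \<longleftrightarrow>
     is_semigroup S \<and> countable (carrier S) \<and>
     (\<forall>n\<ge>1. finite (orbits (AutoGroup S) {xs. length xs = n \<and> set xs \<subseteq> carrier S} map))"

definition sg_ideal :: "('a, 'b) monoid_scheme \<Rightarrow> 'a set \<Rightarrow> bool" where
  "sg_ideal S I \<longleftrightarrow>
     I \<noteq> {} \<and> I \<subseteq> carrier S \<and>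
     (\<forall>x\<in>I. \<forall>s\<in>carrier S. s \<otimes>\<^bsub>S\<^esub> x \<in> I \<and> x \<otimes>\<^bsub>S\<^esub> s \<in> I)"

definition sg_kernel :: "('a, 'b) monoid_scheme \<Rightarrow> 'a set \<Rightarrow> bool" where
  "sg_kernel S K \<longleftrightarrow> sg_ideal S K \<and> (\<forall>L. sg_ideal S L \<longrightarrow> K \<subseteq> L)"

text \<open>\<open>S\<^sup>1 a S\<^sup>1\<close> written out; the four parts come from multiplying by the (possibly adjoined)
  identity on both sides, on one side, or on neither.\<close>

definition J_ideal :: "('a, 'b) monoid_scheme \<Rightarrow> 'a \<Rightarrow> 'a set" where
  "J_ideal S a =
     {a} \<union> {s \<otimes>\<^bsub>S\<^esub> a | s. s \<in> carrier S} \<union> {a \<otimes>\<^bsub>S\<^esub> t | t. t \<in> carrier S}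
     \<union> {(s \<otimes>\<^bsub>S\<^esub> a) \<otimes>\<^bsub>S\<^esub> t | s t. s \<in> carrier S \<and> t \<in> carrier S}"

definition J_class :: "('a, 'b) monoid_scheme \<Rightarrow> 'a \<Rightarrow> 'a set" where
  "J_class S a = {b \<in> carrier S. J_ideal S b = J_ideal S a}"

definition I_set :: "('a, 'b) monoid_scheme \<Rightarrow> 'a \<Rightarrow> 'a set" where
  "I_set S a = J_ideal S a - J_class S a"

definition rees_congruence :: "('a, 'b) monoid_scheme \<Rightarrow> 'a set \<Rightarrow> ('a \<times> 'a) set" where
  "rees_congruence T I =
     {(x, y). x \<in> carrier T \<and> y \<in> carrier T \<and> (x = y \<or> (x \<in> I \<and> y \<in> I))}"

text \<open>The product of two classes is the class of the product of any representatives
  (see \<open>rees_quotient_mult\<close> below).\<close>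

definition rees_quotient :: "('a, 'b) monoid_scheme \<Rightarrow> 'a set \<Rightarrow> 'a set monoid" where
  "rees_quotient T I =
     \<lparr>carrier = carrier T // rees_congruence T I,
      mult = (\<lambda>X Y. \<Union>x\<in>X. \<Union>y\<in>Y. rees_congruence T I `` {x \<otimes>\<^bsub>T\<^esub> y}),
      one = undefined\<rparr>"

text \<open>The kernel \<open>K\<close> is represented by \<open>K/\<emptyset>\<close>, its copy consisting of the singletons of its
  elements (see \<open>kernel_iso_rees_quotient_empty\<close> below), so that all principal factors have the
  same type.\<close>

definition principal_factors :: "('a, 'b) monoid_scheme \<Rightarrow> 'a set monoid set" where
  "principal_factors S =
     {rees_quotient (S\<lparr>carrier := J_ideal S a\<rparr>) (I_set S a) | a. a \<in> carrier S \<and> I_set S a \<noteq> {}}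
     \<union> {rees_quotient (S\<lparr>carrier := K\<rparr>) {} | K. sg_kernel S K}"

definition idempotents :: "('a, 'b) monoid_scheme \<Rightarrow> 'a set" where
  "idempotents S = {e \<in> carrier S. e \<otimes>\<^bsub>S\<^esub> e = e}"

definition idem_le :: "('a, 'b) monoid_scheme \<Rightarrow> 'a \<Rightarrow> 'a \<Rightarrow> bool" where
  "idem_le S f e \<longleftrightarrow> f \<otimes>\<^bsub>S\<^esub> e = f \<and> e \<otimes>\<^bsub>S\<^esub> f = f"

definition is_zero :: "('a, 'b) monoid_scheme \<Rightarrow> 'a \<Rightarrow> bool" where
  "is_zero S z \<longleftrightarrow> z \<in> carrier S \<and> (\<forall>x\<in>carrier S. z \<otimes>\<^bsub>S\<^esub> x = z \<and> x \<otimes>\<^bsub>S\<^esub> z = z)"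

text \<open>Simple (respectively 0-simple) with a primitive idempotent: one that is minimal among all
  (respectively among all nonzero) idempotents.\<close>

definition completely_simple :: "('a, 'b) monoid_scheme \<Rightarrow> bool" where
  "completely_simple S \<longleftrightarrow>
     is_semigroup S \<and>
     (\<forall>I. sg_ideal S I \<longrightarrow> I = carrier S) \<and>
     (\<exists>e\<in>idempotents S. \<forall>f\<in>idempotents S. idem_le S f e \<longrightarrow> f = e)"

definition completely_0_simple :: "('a, 'b) monoid_scheme \<Rightarrow> bool" where
  "completely_0_simple S \<longleftrightarrow>
     is_semigroup S \<and>
     (\<exists>z. is_zero S z \<and>
        (\<exists>x\<in>carrier S. \<exists>y\<in>carrier S. x \<otimes>\<^bsub>S\<^esub> y \<noteq> z) \<and>
        (\<forall>I. sg_ideal S I \<longrightarrow> I = {z} \<or> I = carrier S) \<and>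
        (\<exists>e\<in>idempotents S. e \<noteq> z \<and>
           (\<forall>f\<in>idempotents S. idem_le S f e \<longrightarrow> f = z \<or> f = e)))"

definition null_semigroup :: "('a, 'b) monoid_scheme \<Rightarrow> bool" where
  "null_semigroup S \<longleftrightarrow>
     is_semigroup S \<and>
     (\<exists>z. is_zero S z \<and> (\<forall>x\<in>carrier S. \<forall>y\<in>carrier S. x \<otimes>\<^bsub>S\<^esub> y = z))"

definition iso_classes :: "('a, 'b) monoid_scheme set \<Rightarrow> ('a, 'b) monoid_scheme set set" where
  "iso_classes F = F // {(P, Q). P \<in> F \<and> Q \<in> F \<and> P \<cong> Q}"


lemma rees_quotient_mult:
  assumes "is_semigroup T" and "I = {} \<or> sg_ideal T I"
    and "x \<in> carrier T" and "y \<in> carrier T"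
  shows "(rees_congruence T I `` {x}) \<otimes>\<^bsub>rees_quotient T I\<^esub> (rees_congruence T I `` {y})
         = rees_congruence T I `` {x \<otimes>\<^bsub>T\<^esub> y}"
proof -
  let ?r = "rees_congruence T I"
  have cl: "x' \<otimes>\<^bsub>T\<^esub> y' \<in> carrier T" if "x' \<in> carrier T" "y' \<in> carrier T" for x' y'
    using assms(1) that by (auto simp: is_semigroup_def)
  have I: "x' \<otimes>\<^bsub>T\<^esub> y' \<in> I" if "x' \<in> I \<and> y' \<in> carrier T \<or> x' \<in> carrier T \<and> y' \<in> I" for x' y'
    using assms(2) that by (auto simp: sg_ideal_def)
  have "?r `` {x' \<otimes>\<^bsub>T\<^esub> y'} = ?r `` {x \<otimes>\<^bsub>T\<^esub> y}"
    if "x' \<in> ?r `` {x}" "y' \<in> ?r `` {y}" for x' y'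
  proof -
    have *: "x' \<in> carrier T" "y' \<in> carrier T"
      "x' = x \<or> x' \<in> I \<and> x \<in> I" "y' = y \<or> y' \<in> I \<and> y \<in> I"
      using that by (auto simp: rees_congruence_def)
    then have "x' \<otimes>\<^bsub>T\<^esub> y' = x \<otimes>\<^bsub>T\<^esub> y \<or> x' \<otimes>\<^bsub>T\<^esub> y' \<in> I \<and> x \<otimes>\<^bsub>T\<^esub> y \<in> I"
      using I assms(3,4) by blast
    then show ?thesis
      using cl[OF *(1,2)] cl[OF assms(3,4)] by (auto simp: rees_congruence_def)
  qed
  then have "(\<Union>x'\<in>?r `` {x}. \<Union>y'\<in>?r `` {y}. ?r `` {x' \<otimes>\<^bsub>T\<^esub> y'})
      = (\<Union>x'\<in>?r `` {x}. \<Union>y'\<in>?r `` {y}. ?r `` {x \<otimes>\<^bsub>T\<^esub> y})"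
    by (intro SUP_cong refl)
  moreover have "x \<in> ?r `` {x}" "y \<in> ?r `` {y}"
    using assms(3,4) by (auto simp: rees_congruence_def)
  ultimately show ?thesis
    unfolding rees_quotient_def monoid.simps by blast
qed

lemma kernel_iso_rees_quotient_empty:
  assumes "is_semigroup S" and "sg_kernel S K"
  shows "S\<lparr>carrier := K\<rparr> \<cong> rees_quotient (S\<lparr>carrier := K\<rparr>) {}"
proof -
  let ?T = "S\<lparr>carrier := K\<rparr>"
  have K: "K \<noteq> {}" "K \<subseteq> carrier S" "\<And>x y. x \<in> K \<Longrightarrow> y \<in> K \<Longrightarrow> x \<otimes>\<^bsub>S\<^esub> y \<in> K"
    using assms(2) by (auto simp: sg_kernel_def sg_ideal_def)
  have T: "is_semigroup ?T"
    using K assms(1) unfolding is_semigroup_def by (simp add: subset_iff)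
  have m: "(rees_congruence ?T {} `` {x}) \<otimes>\<^bsub>rees_quotient ?T {}\<^esub> (rees_congruence ?T {} `` {y})
      = rees_congruence ?T {} `` {x \<otimes>\<^bsub>S\<^esub> y}" if "x \<in> K" "y \<in> K" for x y
    using rees_quotient_mult[OF T, of "{}" x y] that by simp
  have c: "rees_congruence ?T {} `` {x} = {x}" if "x \<in> K" for x
    using that by (auto simp: rees_congruence_def)
  have car: "carrier (rees_quotient ?T {}) = (\<lambda>x. {x}) ` K"
    using c by (auto simp: rees_quotient_def quotient_def)
  have "(\<lambda>x. {x}) \<in> hom ?T (rees_quotient ?T {})"
  proof (rule homI)
    fix x y assume "x \<in> carrier ?T" "y \<in> carrier ?T"
    then have "x \<in> K" "y \<in> K" by simp_all
    then show "{x \<otimes>\<^bsub>?T\<^esub> y} = {x} \<otimes>\<^bsub>rees_quotient ?T {}\<^esub> {y}"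
      using m[of x y] c[of x] c[of y] c[of "x \<otimes>\<^bsub>S\<^esub> y"] K(3)[of x y] by simp
  qed (simp add: car)
  moreover have "bij_betw (\<lambda>x. {x}) (carrier ?T) (carrier (rees_quotient ?T {}))"
    by (simp add: car bij_betw_def)
  ultimately show ?thesis
    unfolding is_iso_def iso_def by blast
qed

end

theory Submission
  imports Defs
begin

text \<open>
  Automorphisms fixing \<open>a\<close> act on the principal factor of \<open>a\<close>, so its \<open>n\<close>-orbits are bounded by
  the \<open>(n+1)\<close>-orbits of \<open>S\<close> on tuples starting with \<open>a\<close>; automorphisms taking \<open>a\<close> to \<open>b\<close> induce an
  isomorphism of principal factors, so there are at most as many of these as \<open>1\<close>-orbits.  Each
  principal factor is null, 0-simple or simple, and it is periodic, because finitely many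
  \<open>2\<close>-orbits force \<open>(a, a\<^sup>k)\<close> and \<open>(a, a\<^sup>l)\<close> to be conjugate for some \<open>k < l\<close>.
  Periodic simple and 0-simple semigroups are completely simple and completely 0-simple: if
  \<open>e = xfy\<close> with \<open>f \<le> e\<close>, periodicity of \<open>x\<close> gives \<open>f = e\<close>.
\<close>

section \<open>Basic laws of a semigroup\<close>

locale sgrp =
  fixes S :: "('a, 'b) monoid_scheme" (structure)
  assumes sg: "is_semigroup S"
begin

lemma closed [simp, intro]: "x \<in> carrier S \<Longrightarrow> y \<in> carrier S \<Longrightarrow> x \<otimes> y \<in> carrier S"
  using sg by (auto simp: is_semigroup_def)

lemma assoc: "x \<in> carrier S \<Longrightarrow> y \<in> carrier S \<Longrightarrow> z \<in> carrier S \<Longrightarrow> x \<otimes> y \<otimes> z = x \<otimes> (y \<otimes> z)"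
  using sg by (auto simp: is_semigroup_def)

end

section \<open>Periodic semigroups\<close>

text \<open>\<open>spow S x n\<close> is \<open>x\<^sup>n\<^sup>+\<^sup>1\<close>, as there is no identity.\<close>

primrec spow :: "('a, 'b) monoid_scheme \<Rightarrow> 'a \<Rightarrow> nat \<Rightarrow> 'a" where
  "spow S x 0 = x"
| "spow S x (Suc n) = x \<otimes>\<^bsub>S\<^esub> spow S x n"

definition periodic :: "('a, 'b) monoid_scheme \<Rightarrow> bool" where
  "periodic S \<longleftrightarrow> (\<forall>x\<in>carrier S. \<exists>m n. m < n \<and> spow S x m = spow S x n)"

context sgrp
begin

lemma spow_closed [simp, intro]: "x \<in> carrier S \<Longrightarrow> spow S x n \<in> carrier S"
  by (induction n) auto

lemma spow_add: "x \<in> carrier S \<Longrightarrow> spow S x m \<otimes> spow S x n = spow S x (Suc (m + n))"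
  by (induction m) (auto simp: assoc)

text \<open>A coincidence of two powers persists when both are multiplied by a further power of
  \<open>x\<close>, so from index \<open>m\<close> on a shift by \<open>p\<close> changes nothing,
  and such shifts can be iterated.\<close>

lemma spow_shift:
  assumes "x \<in> carrier S" "spow S x m = spow S x (m + p)"
  shows "spow S x (m + j) = spow S x (m + j + i * p)"
proof -
  have step: "spow S x (m + k) = spow S x (m + k + p)" for k
  proof (cases k)
    case (Suc l)
    then show ?thesis
      using spow_add[OF assms(1), of m l] spow_add[OF assms(1), of "m + p" l] assms(2)
      by (simp add: ac_simps)
  qed (use assms in simp)
  show ?thesis
  proof (induction i)
    case (Suc i)
    then show ?case
      using step[of "j + i * p"] by (simp add: ac_simps)
  qed simp
qed

lemma spow_idempotent:
  assumes "periodic S" "x \<in> carrier S"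
  shows "\<exists>n. spow S x n \<otimes> spow S x n = spow S x n"
proof -
  from assms obtain m n where mn: "m < n" "spow S x m = spow S x n"
    unfolding periodic_def by blast
  define p where "p = n - m"
  have p: "p \<ge> 1" "n = m + p"
    using mn(1) by (auto simp: p_def)
  have "m + 1 \<le> (m + 1) * p"
    using mult_le_mono2[OF p(1), of "m + 1"] by simp
  \<comment> \<open>The power with index \<open>m + j\<close> has exponent
    \<open>m + j + 1 = (m + 1) * p\<close>, a multiple of the period and past the start of the
    cycle. Squaring it therefore shifts the exponent by whole periods.\<close>
  then obtain j where j: "(m + 1) * p = m + j + 1"
    by (metis add.commute add.left_commute le_iff_add)
  have "spow S x (m + j) \<otimes> spow S x (m + j) = spow S x (m + j + (m + 1) * p)"
    using spow_add[OF assms(2)] j by simp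
  also have "\<dots> = spow S x (m + j)"
    using spow_shift[of x m p j "m + 1"] assms(2) mn(2) p(2) by simp
  finally show ?thesis ..
qed

text \<open>Substituting the equation for \<open>a\<close> into itself wraps further copies of
  \<open>x\<close> and \<open>y\<close> around \<open>a\<close>. This lets \<open>x\<close> be
  replaced by an idempotent power of itself.\<close>

lemma spow_sandwich:
  assumes "x \<in> carrier S" "y \<in> carrier S" "a \<in> carrier S" "a = x \<otimes> a \<otimes> y"
  shows "a = spow S x n \<otimes> a \<otimes> spow S y n"
proof (induction n)
  case (Suc n)
  have "a = x \<otimes> (spow S x n \<otimes> a \<otimes> spow S y n) \<otimes> y"
    using assms(4) Suc by simp
  also have "\<dots> = (x \<otimes> spow S x n) \<otimes> a \<otimes> (spow S y n \<otimes> y)"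
    using assms by (simp add: assoc)
  also have "spow S y n \<otimes> y = spow S y (Suc n)"
    using spow_add[of y n 0] assms(2) by simp
  finally show ?case
    by simp
qed (use assms in simp)

text \<open>From \<open>x y = e\<close> follows \<open>x^k y^k = e\<close> for all
  \<open>k >= 1\<close>. If \<open>x^i = x^k\<close> with \<open>i < k\<close>, multiplying by
  \<open>y^i\<close> on the right turns \<open>x^i\<close> into \<open>e\<close> and leaves
  \<open>e = x^(k - i)\<close>.\<close>

lemma left_inverse_periodic:
  assumes "periodic S" "x \<in> carrier S" "y \<in> carrier S" "e \<in> carrier S"
    and xy: "x \<otimes> y = e" and xe: "x \<otimes> e = x" and ey: "e \<otimes> y = y"
  shows "\<exists>n. spow S x n = e"
proof -
  have xy_pow: "spow S x n \<otimes> spow S y n = e" for n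
  proof (induction n)
    case (Suc n)
    have "spow S x (Suc n) \<otimes> spow S y (Suc n) = (spow S x n \<otimes> x) \<otimes> (y \<otimes> spow S y n)"
      using spow_add[of x n 0] assms(2) by simp
    also have "\<dots> = spow S x n \<otimes> ((x \<otimes> y) \<otimes> spow S y n)"
      using assms(2,3) by (simp add: assoc)
    also have "(x \<otimes> y) \<otimes> spow S y n = spow S y n"
      unfolding xy using ey assms(3,4) by (cases n) (simp_all flip: assoc)
    finally show ?case
      using Suc by simp
  qed (use xy in simp)
  from assms(1,2) obtain m n where mn: "m < n" "spow S x m = spow S x n"
    unfolding periodic_def by blast
  \<comment> \<open>The exponent that remains is \<open>n - m\<close>, hence the index
    \<open>n - m - 1\<close>.\<close>
  define l where "l = n - m - 1"
  have n: "n = Suc (l + m)"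
    using mn(1) by (simp add: l_def)
  have "e = spow S x n \<otimes> spow S y m"
    using xy_pow[of m] mn(2) by simp
  also have "\<dots> = spow S x l \<otimes> (spow S x m \<otimes> spow S y m)"
    unfolding n using assms by (simp add: spow_add flip: assoc)
  also have "\<dots> = spow S x l \<otimes> e"
    by (simp add: xy_pow)
  also have "\<dots> = spow S x l"
  proof (cases l)
    case (Suc k)
    have "spow S x l = spow S x k \<otimes> x"
      using Suc spow_add[of x k 0] assms(2) by simp
    then show ?thesis
      using xe assms(2,4) by (simp add: assoc)
  qed (use xe in simp)
  finally show ?thesis
    by (intro exI) (rule sym)
qed

text \<open>Simple semigroups are the case \<open>Z = {}\<close>, 0-simple ones the case that \<open>Z\<close> contains just the
  zero.\<close>

lemma primitive_idempotent:
  assumes per: "periodic S" and ne: "carrier S - Z \<noteq> {}"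
    and Z: "\<And>z s. z \<in> Z \<Longrightarrow> s \<in> carrier S \<Longrightarrow> s \<otimes> z \<in> Z \<and> z \<otimes> s \<in> Z"
    and simple: "\<And>x y. x \<in> carrier S - Z \<Longrightarrow> y \<in> carrier S \<Longrightarrow>
      \<exists>p\<in>carrier S. \<exists>q\<in>carrier S. y = p \<otimes> x \<otimes> q"
  shows "\<exists>e\<in>idempotents S. e \<notin> Z \<and> (\<forall>f\<in>idempotents S. idem_le S f e \<longrightarrow> f \<in> Z \<or> f = e)"
proof -
  from ne obtain a where a: "a \<in> carrier S" "a \<notin> Z"
    by blast
  \<comment> \<open>Simplicity is applied to \<open>a\<close> and \<open>a\<close> itself; an
    idempotent power of the left multiplier will be the primitive idempotent.\<close>
  then obtain x y where xy: "x \<in> carrier S" "y \<in> carrier S" "a = x \<otimes> a \<otimes> y"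
    using simple by blast
  obtain n where n: "spow S x n \<otimes> spow S x n = spow S x n"
    using spow_idempotent per xy(1) by blast
  define e where "e = spow S x n"
  have "a = e \<otimes> a \<otimes> spow S y n"
    unfolding e_def using xy a by (intro spow_sandwich)
  \<comment> \<open>If \<open>e\<close> were in \<open>Z\<close>, absorption would put
    \<open>a\<close> into \<open>Z\<close> as well.\<close>
  with a xy have "e \<notin> Z"
    using Z by (metis spow_closed)
  moreover have e: "e \<in> idempotents S" "e \<in> carrier S" "e \<otimes> e = e"
    using n xy(1) by (auto simp: e_def idempotents_def)
  moreover have "f = e" if f: "f \<in> idempotents S" "idem_le S f e" "f \<notin> Z" for f
  proof -
    have f': "f \<in> carrier S" "f \<otimes> f = f" "f \<otimes> e = f" "e \<otimes> f = f"
      using f by (auto simp: idempotents_def idem_le_def)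
    obtain p q where pq: "p \<in> carrier S" "q \<in> carrier S" "e = p \<otimes> f \<otimes> q"
      using simple f' f(3) e by blast
    \<comment> \<open>Compressing \<open>p\<close> and \<open>q\<close> by \<open>e\<close> and
      \<open>f\<close> keeps the product equal to \<open>e\<close> and gives the one-sided
      identities that make \<open>e\<close> a power of \<open>u\<close>. As \<open>u f = u\<close>,
      that power satisfies \<open>e f = e\<close>, whereas \<open>idem_le S f e\<close> gives
      \<open>e f = f\<close>.\<close>
    define u v where "u = e \<otimes> p \<otimes> f" and "v = f \<otimes> q \<otimes> e"
    have uv: "u \<in> carrier S" "v \<in> carrier S"
      using pq f' e by (auto simp: u_def v_def)
    have uf: "u \<otimes> f = u" and ue: "u \<otimes> e = u" and ev: "e \<otimes> v = v"
      using pq f' e by (simp_all add: u_def v_def assoc) (simp_all add: f' flip: assoc)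
    have "u \<otimes> v = e \<otimes> (p \<otimes> (f \<otimes> f) \<otimes> q) \<otimes> e"
      unfolding u_def v_def using pq(1,2) f'(1) e(2) by (simp add: assoc)
    also have "\<dots> = e"
      using f'(2) pq(3) e(3) by simp
    finally have "u \<otimes> v = e" .
    then obtain k where k: "spow S u k = e"
      using left_inverse_periodic per uv e ue ev by blast
    have "spow S u k \<otimes> f = spow S u k"
    proof (cases k)
      case (Suc l)
      have "spow S u k = spow S u l \<otimes> u"
        using Suc spow_add[of u l 0] uv(1) by simp
      then show ?thesis
        using uf uv f' by (simp add: assoc)
    qed (use uf in simp)
    then show "f = e"
      using k f' by simp
  qed
  ultimately show ?thesis
    by blast
qed

end

section \<open>Principal ideals\<close>

context sgrp
begin

lemma J_ideal_cases:
  assumes "b \<in> J_ideal S a"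
  obtains "b = a"
  | s where "s \<in> carrier S" "b = s \<otimes> a"
  | t where "t \<in> carrier S" "b = a \<otimes> t"
  | s t where "s \<in> carrier S" "t \<in> carrier S" "b = s \<otimes> a \<otimes> t"
  using assms unfolding J_ideal_def by blast

lemma self_in_J_ideal: "a \<in> J_ideal S a"
  by (simp add: J_ideal_def)

lemma sg_ideal_J_ideal:
  assumes "a \<in> carrier S"
  shows "sg_ideal S (J_ideal S a)"
proof -
  have "s \<otimes> x \<in> J_ideal S a \<and> x \<otimes> s \<in> J_ideal S a"
    if "x \<in> J_ideal S a" and s: "s \<in> carrier S" for x s
    using that(1)
  proof (cases rule: J_ideal_cases)
    case 1
    then show ?thesis
      using s by (auto simp: J_ideal_def)
  next
    case (2 u)
    then have "s \<otimes> x = (s \<otimes> u) \<otimes> a" "x \<otimes> s = u \<otimes> a \<otimes> s"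
      using s assms by (simp_all add: assoc)
    then show ?thesis
      using 2 s by (auto simp: J_ideal_def)
  next
    case (3 u)
    then have "s \<otimes> x = s \<otimes> a \<otimes> u" "x \<otimes> s = a \<otimes> (u \<otimes> s)"
      using s assms by (simp_all add: assoc)
    then show ?thesis
      using 3 s unfolding J_ideal_def by blast
  next
    case (4 u v)
    then have "s \<otimes> x = (s \<otimes> u) \<otimes> a \<otimes> v" "x \<otimes> s = u \<otimes> a \<otimes> (v \<otimes> s)"
      using s assms by (simp_all add: assoc)
    then show ?thesis
      using 4 s unfolding J_ideal_def by blast
  qed
  moreover have "J_ideal S a \<subseteq> carrier S"
    using assms by (auto simp: J_ideal_def)
  ultimately show ?thesis
    using self_in_J_ideal[of a] by (auto simp: sg_ideal_def)
qed

lemma J_ideal_least: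
  assumes "sg_ideal S I" "a \<in> I"
  shows "J_ideal S a \<subseteq> I"
  using assms unfolding sg_ideal_def J_ideal_def by blast

lemma J_ideal_carrier: "a \<in> carrier S \<Longrightarrow> b \<in> J_ideal S a \<Longrightarrow> b \<in> carrier S"
  using sg_ideal_J_ideal by (auto simp: sg_ideal_def)

lemma J_ideal_mono: "a \<in> carrier S \<Longrightarrow> b \<in> J_ideal S a \<Longrightarrow> J_ideal S b \<subseteq> J_ideal S a"
  using J_ideal_least sg_ideal_J_ideal by blast

text \<open>For \<open>b\<close> in J(a), J(b) lies in J(a), so the two ideals are equal as soon as
  \<open>a\<close> lies in J(b). This trades equality of ideals for a membership.\<close>

lemma I_set_iff:
  assumes "a \<in> carrier S"
  shows "b \<in> I_set S a \<longleftrightarrow> b \<in> J_ideal S a \<and> a \<notin> J_ideal S b"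
proof -
  have "J_ideal S b = J_ideal S a \<longleftrightarrow> a \<in> J_ideal S b" if "b \<in> J_ideal S a"
    using that J_ideal_mono[of a b] J_ideal_mono[of b a] J_ideal_carrier[of a b] assms
      self_in_J_ideal by blast
  then show ?thesis
    using J_ideal_carrier[of a b] assms by (auto simp: I_set_def J_class_def)
qed

lemma J_ideal_eq: "a \<in> carrier S \<Longrightarrow> b \<in> J_ideal S a \<Longrightarrow> b \<notin> I_set S a \<Longrightarrow> J_ideal S b = J_ideal S a"
  by (auto simp: I_set_def J_class_def)

text \<open>The ideals generated by \<open>s x\<close> and \<open>x s\<close> are contained in J(x),
  which does not contain \<open>a\<close>, so multiplication by elements of \<open>S\<close> never
  leads back to the class of \<open>a\<close>.\<close>

lemma I_set_absorbs:
  assumes "a \<in> carrier S" "x \<in> I_set S a" "s \<in> carrier S"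
  shows "s \<otimes> x \<in> I_set S a \<and> x \<otimes> s \<in> I_set S a"
proof -
  have x: "x \<in> J_ideal S a" "x \<in> carrier S" "a \<notin> J_ideal S x"
    using assms I_set_iff J_ideal_carrier by auto
  have "s \<otimes> x \<in> J_ideal S a \<and> x \<otimes> s \<in> J_ideal S a"
    using sg_ideal_J_ideal[OF assms(1)] x(1) assms(3) unfolding sg_ideal_def by blast
  moreover have "s \<otimes> x \<in> J_ideal S x \<and> x \<otimes> s \<in> J_ideal S x"
    using sg_ideal_J_ideal[OF x(2)] self_in_J_ideal assms(3) unfolding sg_ideal_def by blast
  ultimately show ?thesis
    using I_set_iff[OF assms(1)] J_ideal_mono[OF x(2)] x(3) by blast
qed

lemma is_semigroup_J_ideal:
  assumes "a \<in> carrier S"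
  shows "is_semigroup (S\<lparr>carrier := J_ideal S a\<rparr>)"
  using sg_ideal_J_ideal[OF assms] assoc
  unfolding is_semigroup_def sg_ideal_def by (simp add: subset_iff)

lemma I_set_empty_or_ideal:
  assumes "a \<in> carrier S"
  shows "I_set S a = {} \<or> sg_ideal (S\<lparr>carrier := J_ideal S a\<rparr>) (I_set S a)"
  using I_set_absorbs[OF assms] J_ideal_carrier[OF assms]
  by (auto simp: sg_ideal_def I_set_def)

text \<open>A single product \<open>b c\<close> that stays in the J-class forces the factor to be
  simple or 0-simple. The point is that both multipliers come from J(a) itself: elements of
  \<open>S\<close> that occur as multipliers are absorbed into neighbours lying in the
  ideal.\<close>

lemma J_class_product_sandwich:
  assumes a: "a \<in> carrier S"
    and bc: "b \<in> J_ideal S a" "c \<in> J_ideal S a" "b \<otimes> c \<notin> I_set S a"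
    and x: "x \<in> J_ideal S a" "x \<notin> I_set S a" and y: "y \<in> J_ideal S a"
  shows "\<exists>p\<in>J_ideal S a. \<exists>q\<in>J_ideal S a. y = p \<otimes> x \<otimes> q"
proof -
  let ?J = "J_ideal S a"
  note carr = J_ideal_carrier[OF a]
  have J: "s \<otimes> g \<in> ?J" "g \<otimes> s \<in> ?J" if "g \<in> ?J" "s \<in> carrier S" for g s
    using sg_ideal_J_ideal[OF a] that by (auto simp: sg_ideal_def)
  have [simp]: "b \<in> carrier S" "c \<in> carrier S" "x \<in> carrier S"
    using bc x carr by auto
  have bcJ: "J_ideal S (b \<otimes> c) = ?J"
    using a bc J by (intro J_ideal_eq) auto
  have "b \<in> J_ideal S (b \<otimes> c)"
    using bcJ bc by simp
  \<comment> \<open>Replacing the \<open>b\<close> in \<open>b c\<close> by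
    \<open>s (b c) t\<close>, where \<open>s\<close> or \<open>t\<close> may be absent, puts
    \<open>c\<close> between two elements of the ideal: a multiple of \<open>b\<close> on the left
    and a multiple of \<open>c\<close> on the right.\<close>
  then have "\<exists>g\<in>?J. \<exists>h\<in>?J. b \<otimes> c = g \<otimes> c \<otimes> h"
  proof (cases rule: J_ideal_cases)
    case 1
    then have "b \<otimes> c = b \<otimes> c \<otimes> c" by simp
    then show ?thesis using bc by blast
  next
    case (2 s)
    then have "b \<otimes> c = (s \<otimes> b) \<otimes> c \<otimes> c"
      by (metis assoc \<open>b \<in> carrier S\<close> \<open>c \<in> carrier S\<close>)
    then show ?thesis using bc J 2 by blast
  next
    case (3 t)
    then have "b \<otimes> c = b \<otimes> c \<otimes> (t \<otimes> c)"
      by (metis assoc closed \<open>b \<in> carrier S\<close> \<open>c \<in> carrier S\<close>)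
    then show ?thesis using bc J 3 by blast
  next
    case (4 s t)
    then have "b \<otimes> c = (s \<otimes> b) \<otimes> c \<otimes> (t \<otimes> c)"
      by (metis assoc closed \<open>b \<in> carrier S\<close> \<open>c \<in> carrier S\<close>)
    then show ?thesis using bc J 4 by blast
  qed
  then obtain g h where gh: "g \<in> ?J" "h \<in> ?J" "b \<otimes> c = g \<otimes> c \<otimes> h"
    by blast
  then have [simp]: "g \<in> carrier S" "h \<in> carrier S"
    using carr by auto
  have "c \<in> J_ideal S x"
    using J_ideal_eq[OF a x] bc by simp
  \<comment> \<open>As \<open>x\<close> generates the same ideal, \<open>c\<close> is a multiple of
    \<open>x\<close>; its multipliers are absorbed by \<open>g\<close> and \<open>h\<close>.\<close>
  then have "\<exists>p\<in>?J. \<exists>q\<in>?J. b \<otimes> c = p \<otimes> x \<otimes> q"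
  proof (cases rule: J_ideal_cases)
    case 1
    then show ?thesis using gh by blast
  next
    case (2 s)
    then have "b \<otimes> c = (g \<otimes> s) \<otimes> x \<otimes> h"
      using gh by (simp add: assoc)
    then show ?thesis using gh J 2 by blast
  next
    case (3 t)
    then have "b \<otimes> c = g \<otimes> x \<otimes> (t \<otimes> h)"
      using gh by (simp add: assoc)
    then show ?thesis using gh J 3 by blast
  next
    case (4 s t)
    then have "b \<otimes> c = (g \<otimes> s) \<otimes> x \<otimes> (t \<otimes> h)"
      using gh by (simp add: assoc)
    then show ?thesis using gh J 4 by blast
  qed
  then obtain p q where pq: "p \<in> ?J" "q \<in> ?J" "b \<otimes> c = p \<otimes> x \<otimes> q"
    by blast
  then have [simp]: "p \<in> carrier S" "q \<in> carrier S"
    using carr by auto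
  \<comment> \<open>The product \<open>b c\<close> generates the whole ideal, so \<open>y\<close> is
    a multiple of it; the new outer factors are absorbed by \<open>p\<close> and
    \<open>q\<close>.\<close>
  have "y \<in> J_ideal S (p \<otimes> x \<otimes> q)"
    using bcJ pq y by simp
  then show ?thesis
  proof (cases rule: J_ideal_cases)
    case 1
    then show ?thesis using pq by blast
  next
    case (2 s)
    then have "y = (s \<otimes> p) \<otimes> x \<otimes> q"
      by (simp add: assoc)
    then show ?thesis using pq J 2 by blast
  next
    case (3 t)
    then have "y = p \<otimes> x \<otimes> (q \<otimes> t)"
      by (simp add: assoc)
    then show ?thesis using pq J 3 by blast
  next
    case (4 s t)
    then have "y = (s \<otimes> p) \<otimes> x \<otimes> (q \<otimes> t)"
      by (simp add: assoc)
    then show ?thesis using pq J 4 by blast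
  qed
qed

text \<open>Minimality makes every element of the kernel generate all of it, so the kernel is a
  single J-class. It can thus be treated as the principal factor of any of its elements.\<close>

lemma sg_kernel_eq_J_ideal:
  assumes "sg_kernel S K" "a \<in> K"
  shows "K = J_ideal S a" "I_set S a = {}"
proof -
  have K: "sg_ideal S K" "\<And>L. sg_ideal S L \<Longrightarrow> K \<subseteq> L"
    using assms by (auto simp: sg_kernel_def)
  have eq: "K = J_ideal S x" if "x \<in> K" for x
  proof
    have "x \<in> carrier S"
      using that K(1) by (auto simp: sg_ideal_def)
    then show "K \<subseteq> J_ideal S x"
      using K(2) sg_ideal_J_ideal by blast
  qed (rule J_ideal_least[OF K(1) that])
  show "K = J_ideal S a"
    using eq assms(2) .
  have "a \<in> carrier S"
    using K assms(2) by (auto simp: sg_ideal_def)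
  then show "I_set S a = {}"
    using eq assms(2) by (auto simp: I_set_iff)
qed

end

section \<open>Isomorphisms of Rees quotients\<close>

lemma rees_congruence_image:
  assumes "bij_betw \<phi> (carrier T) (carrier T')" "\<phi> ` I = I'" "I \<subseteq> carrier T" "x \<in> carrier T"
  shows "rees_congruence T' I' `` {\<phi> x} = \<phi> ` (rees_congruence T I `` {x})"
proof -
  have inj: "\<phi> u = \<phi> v \<longleftrightarrow> u = v" if "u \<in> carrier T" "v \<in> carrier T" for u v
    using assms(1) that by (auto simp: bij_betw_def inj_on_def)
  have mem: "\<phi> u \<in> I' \<longleftrightarrow> u \<in> I" if "u \<in> carrier T" for u
    using inj that assms(2,3) by (auto simp: image_iff)
  have im: "carrier T' = \<phi> ` carrier T"
    using assms(1) by (simp add: bij_betw_def)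
  show ?thesis
    using assms(4) by (auto simp: rees_congruence_def im inj mem image_iff)
qed

text \<open>An isomorphism that matches the two ideals carries congruence classes onto congruence
  classes, so taking images of sets is the induced map on the quotients.\<close>

lemma rees_quotient_iso:
  assumes \<phi>: "\<phi> \<in> iso T T'" and I: "\<phi> ` I = I'" "I \<subseteq> carrier T" and T: "is_semigroup T"
  shows "(\<lambda>X. \<phi> ` X) \<in> iso (rees_quotient T I) (rees_quotient T' I')"
proof -
  let ?r = "rees_congruence T I" and ?r' = "rees_congruence T' I'"
  have bij: "bij_betw \<phi> (carrier T) (carrier T')"
    using \<phi> by (simp add: iso_def)
  then have inj: "inj_on \<phi> (carrier T)" and im: "carrier T' = \<phi> ` carrier T"
    by (auto simp: bij_betw_def)
  have cls: "?r' `` {\<phi> x} = \<phi> ` (?r `` {x})" if "x \<in> carrier T" for x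
    using rees_congruence_image bij I that by metis
  have car: "carrier (rees_quotient T' I') = (\<lambda>X. \<phi> ` X) ` carrier (rees_quotient T I)"
    using cls by (auto simp: rees_quotient_def quotient_def im image_iff)
  have sub: "X \<subseteq> carrier T" if "X \<in> carrier (rees_quotient T I)" for X
    using that by (auto simp: rees_quotient_def quotient_def rees_congruence_def)
  have "(\<lambda>X. \<phi> ` X) \<in> hom (rees_quotient T I) (rees_quotient T' I')"
  proof (rule homI)
    fix X Y assume XY: "X \<in> carrier (rees_quotient T I)" "Y \<in> carrier (rees_quotient T I)"
    have "?r' `` {\<phi> x \<otimes>\<^bsub>T'\<^esub> \<phi> y} = \<phi> ` (?r `` {x \<otimes>\<^bsub>T\<^esub> y})" if "x \<in> X" "y \<in> Y" for x y
    proof -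
      have xy: "x \<in> carrier T" "y \<in> carrier T"
        using that sub XY by auto
      then have "x \<otimes>\<^bsub>T\<^esub> y \<in> carrier T"
        using T by (auto simp: is_semigroup_def)
      moreover have "\<phi> (x \<otimes>\<^bsub>T\<^esub> y) = \<phi> x \<otimes>\<^bsub>T'\<^esub> \<phi> y"
        using \<phi> xy by (auto simp: iso_def hom_def)
      ultimately show ?thesis
        using cls by metis
    qed
    then show "\<phi> ` (X \<otimes>\<^bsub>rees_quotient T I\<^esub> Y) = \<phi> ` X \<otimes>\<^bsub>rees_quotient T' I'\<^esub> \<phi> ` Y"
      by (simp add: rees_quotient_def image_UN)
  qed (simp add: car)
  moreover have "inj_on (\<lambda>X. \<phi> ` X) (carrier (rees_quotient T I))"
    using sub inj by (auto intro!: inj_onI simp: inj_on_image_eq_iff)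
  ultimately show ?thesis
    by (simp add: iso_def bij_betw_def car)
qed

section \<open>Action of automorphisms on principal ideals and principal factors\<close>

lemma (in sgrp) iso_image_J_ideal:
  assumes "\<phi> \<in> iso S S" "a \<in> carrier S"
  shows "\<phi> ` J_ideal S a = J_ideal S (\<phi> a)"
proof -
  have m: "\<phi> (x \<otimes> y) = \<phi> x \<otimes> \<phi> y" if "x \<in> carrier S" "y \<in> carrier S" for x y
    using assms(1) that by (auto simp: iso_def hom_def)
  have im: "\<phi> ` carrier S = carrier S"
    using assms(1) by (auto simp: iso_def bij_betw_def)
  have J: "J_ideal S u = {u} \<union> (\<lambda>s. s \<otimes> u) ` carrier S \<union> (\<lambda>t. u \<otimes> t) ` carrier S
      \<union> (\<Union>s\<in>carrier S. (\<lambda>t. s \<otimes> u \<otimes> t) ` carrier S)" for u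
    by (auto simp: J_ideal_def)
  \<comment> \<open>Surjectivity lets every multiplier be written as an image under \<phi>, so that
    \<phi> can be pulled out of each of the four parts.\<close>
  have "J_ideal S (\<phi> a) = {\<phi> a} \<union> (\<lambda>s. s \<otimes> \<phi> a) ` \<phi> ` carrier S
      \<union> (\<lambda>t. \<phi> a \<otimes> t) ` \<phi> ` carrier S
      \<union> (\<Union>s\<in>\<phi> ` carrier S. (\<lambda>t. s \<otimes> \<phi> a \<otimes> t) ` \<phi> ` carrier S)"
    unfolding im by (rule J)
  also have "\<dots> = \<phi> ` J_ideal S a"
    unfolding J[of a] using assms(2)
    by (simp add: image_Un image_UN image_image m cong: image_cong)
  finally show ?thesis ..
qed

text \<open>Formed for every \<open>a\<close>, also when \<open>I_set S a\<close> is empty; this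
  covers the kernel, as the factor of any of its elements.\<close>

abbreviation principal_factor :: "('a, 'b) monoid_scheme \<Rightarrow> 'a \<Rightarrow> 'a set monoid" where
  "principal_factor S a \<equiv> rees_quotient (S\<lparr>carrier := J_ideal S a\<rparr>) (I_set S a)"

abbreviation factor_class :: "('a, 'b) monoid_scheme \<Rightarrow> 'a \<Rightarrow> 'a \<Rightarrow> 'a set" where
  "factor_class S a x \<equiv> rees_congruence (S\<lparr>carrier := J_ideal S a\<rparr>) (I_set S a) `` {x}"

context sgrp
begin

lemma auto_iso: "\<phi> \<in> auto S \<Longrightarrow> \<phi> \<in> iso S S"
  by (auto simp: auto_def iso_def Bij_def)

text \<open>By \<open>I_set_iff\<close> the set is described by memberships in principal ideals
  alone, and injectivity of \<phi> preserves these in both directions.\<close>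

lemma iso_image_I_set:
  assumes "\<phi> \<in> iso S S" "a \<in> carrier S"
  shows "\<phi> ` I_set S a = I_set S (\<phi> a)"
proof -
  have J: "\<phi> ` J_ideal S x = J_ideal S (\<phi> x)" if "x \<in> carrier S" for x
    using iso_image_J_ideal assms(1) that .
  have im: "\<phi> ` carrier S = carrier S" and inj: "inj_on \<phi> (carrier S)"
    using assms(1) by (auto simp: iso_def bij_betw_def)
  have \<phi>a: "\<phi> a \<in> carrier S"
    using im assms(2) by blast
  have sub: "J_ideal S x \<subseteq> carrier S" if "x \<in> carrier S" for x
    using J_ideal_carrier that by blast
  have mem: "\<phi> x \<in> I_set S (\<phi> a) \<longleftrightarrow> x \<in> I_set S a" if "x \<in> carrier S" for x
    using that assms(2) \<phi>a sub inj_on_image_mem_iff[OF inj] by (simp add: I_set_iff flip: J)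
  have I_sub: "I_set S u \<subseteq> carrier S" if "u \<in> carrier S" for u
    using that sub by (auto simp: I_set_def)
  show ?thesis
  proof
    show "\<phi> ` I_set S a \<subseteq> I_set S (\<phi> a)"
      using mem I_sub[OF assms(2)] by blast
    show "I_set S (\<phi> a) \<subseteq> \<phi> ` I_set S a"
    proof
      fix y assume y: "y \<in> I_set S (\<phi> a)"
      then obtain x where "x \<in> carrier S" "y = \<phi> x"
        using I_sub[OF \<phi>a] im by blast
      then show "y \<in> \<phi> ` I_set S a"
        using y mem by simp
    qed
  qed
qed

lemma iso_J_ideal:
  assumes "\<phi> \<in> iso S S" "a \<in> carrier S"
  shows "\<phi> \<in> iso (S\<lparr>carrier := J_ideal S a\<rparr>) (S\<lparr>carrier := J_ideal S (\<phi> a)\<rparr>)"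
proof -
  have sub: "J_ideal S a \<subseteq> carrier S"
    using J_ideal_carrier assms(2) by blast
  then have "inj_on \<phi> (J_ideal S a)"
    using assms(1) by (auto simp: iso_def bij_betw_def intro: inj_on_subset)
  moreover have "\<phi> (x \<otimes> y) = \<phi> x \<otimes> \<phi> y" if "x \<in> J_ideal S a" "y \<in> J_ideal S a" for x y
    using assms(1) sub that by (auto simp: iso_def hom_def)
  ultimately show ?thesis
    by (auto simp: iso_def hom_def bij_betw_def iso_image_J_ideal[OF assms, symmetric])
qed

lemma factor_class_image:
  assumes "\<phi> \<in> iso S S" "a \<in> carrier S" "x \<in> J_ideal S a"
  shows "\<phi> ` factor_class S a x = factor_class S (\<phi> a) (\<phi> x)"
proof -
  have "I_set S a \<subseteq> J_ideal S a"
    by (auto simp: I_set_def)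
  then show ?thesis
    using rees_congruence_image[OF _ iso_image_I_set[OF assms(1,2)],
        of "S\<lparr>carrier := J_ideal S a\<rparr>" "S\<lparr>carrier := J_ideal S (\<phi> a)\<rparr>" x]
      iso_J_ideal[OF assms(1,2)] assms(3)
    by (simp add: iso_def)
qed

lemma principal_factor_iso:
  assumes "\<phi> \<in> iso S S" "a \<in> carrier S"
  shows "(\<lambda>X. \<phi> ` X) \<in> iso (principal_factor S a) (principal_factor S (\<phi> a))"
  using iso_J_ideal[OF assms] iso_image_I_set[OF assms] _ is_semigroup_J_ideal[OF assms(2)]
  by (rule rees_quotient_iso) (simp add: I_set_def)

section \<open>Computing in a principal factor\<close>

lemma principal_factor_carrier:
  "carrier (principal_factor S a) = factor_class S a ` J_ideal S a"
  by (auto simp: rees_quotient_def quotient_def)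

lemma principal_factor_mult:
  assumes "a \<in> carrier S" "x \<in> J_ideal S a" "y \<in> J_ideal S a"
  shows "factor_class S a x \<otimes>\<^bsub>principal_factor S a\<^esub> factor_class S a y = factor_class S a (x \<otimes> y)"
  using rees_quotient_mult[OF is_semigroup_J_ideal I_set_empty_or_ideal] assms by simp

lemma factor_class_eq_iff:
  assumes "x \<in> J_ideal S a" "y \<in> J_ideal S a"
  shows "factor_class S a x = factor_class S a y \<longleftrightarrow> x = y \<or> x \<in> I_set S a \<and> y \<in> I_set S a"
  using assms by (auto simp: rees_congruence_def I_set_def)

lemma is_semigroup_principal_factor:
  assumes a: "a \<in> carrier S"
  shows "is_semigroup (principal_factor S a)"
proof -
  have J: "x \<otimes> y \<in> J_ideal S a" if "x \<in> J_ideal S a" "y \<in> J_ideal S a" for x y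
    using that sg_ideal_J_ideal[OF a] J_ideal_carrier[OF a] by (auto simp: sg_ideal_def)
  show ?thesis
    unfolding is_semigroup_def principal_factor_carrier
    using self_in_J_ideal[of a] J_ideal_carrier[OF a]
    by (auto simp: principal_factor_mult[OF a] J assoc)
qed

end

section \<open>Orbits of automorphisms\<close>

context sgrp
begin

lemma same_orbit:
  assumes "set ys \<subseteq> carrier S"
    and "orbit (AutoGroup S) map xs = orbit (AutoGroup S) map ys"
  shows "\<exists>\<phi>\<in>auto S. map \<phi> xs = ys"
proof -
  \<comment> \<open>The identity automorphism puts \<open>ys\<close> into its own orbit. It is
    restricted to the carrier because \<open>auto\<close> consists of extensional maps.\<close>
  let ?id = "\<lambda>x\<in>carrier S. x"
  have "?id \<in> auto S"
    by (auto simp: auto_def hom_def id_Bij)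
  moreover have "map ?id ys = ys"
    using assms(1) by (intro map_idI) auto
  ultimately have "ys \<in> orbit (AutoGroup S) map ys"
    unfolding orbit_def AutoGroup_def by force
  then have "ys \<in> orbit (AutoGroup S) map xs"
    using assms(2) by simp
  then show ?thesis
    by (auto simp: orbit_def AutoGroup_def)
qed

text \<open>Automorphisms compose, so every image of \<open>map \<phi> xs\<close> is an image of
  \<open>xs\<close>. Equality of orbits is later obtained from this inclusion by exchanging the two
  tuples.\<close>

lemma orbit_map_subset:
  assumes "\<phi> \<in> auto S" "set xs \<subseteq> carrier S"
  shows "orbit (AutoGroup S) map (map \<phi> xs) \<subseteq> orbit (AutoGroup S) map xs"
proof
  fix ys assume "ys \<in> orbit (AutoGroup S) map (map \<phi> xs)"
  then obtain \<psi> where \<psi>: "\<psi> \<in> auto S" "ys = map \<psi> (map \<phi> xs)"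
    by (auto simp: orbit_def AutoGroup_def)
  have "compose (carrier S) \<psi> \<phi> \<in> auto S"
    using assms(1) \<psi>(1) unfolding auto_def
    by (auto simp: compose_Bij) (auto simp: hom_def compose_def Pi_iff)
  moreover have "ys = map (compose (carrier S) \<psi> \<phi>) xs"
    using \<psi>(2) assms(2) by (auto simp: compose_def)
  ultimately show "ys \<in> orbit (AutoGroup S) map xs"
    by (auto simp: orbit_def AutoGroup_def)
qed

end

text \<open>On \<open>A\<close> the function \<open>k\<close> factors through \<open>h\<close>:
  choose a preimage for each value of \<open>h\<close>. This transfers finiteness from orbits over
  \<open>S\<close> to coarser classifications.\<close>

lemma finite_image_coarser:
  assumes "finite (h ` A)" and "\<And>x y. x \<in> A \<Longrightarrow> y \<in> A \<Longrightarrow> h x = h y \<Longrightarrow> k x = k y"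
  shows "finite (k ` A)"
proof -
  have "k x = k (inv_into A h (h x))" if "x \<in> A" for x
    using that assms(2) by (metis f_inv_into_f image_eqI inv_into_into)
  then have "k ` A \<subseteq> (\<lambda>u. k (inv_into A h u)) ` h ` A"
    by blast
  then show ?thesis
    using assms(1) by (meson finite_imageI finite_subset)
qed

lemma aleph0_categorical_finite_orbits:
  assumes "aleph0_categorical S" "n \<ge> 1" "A \<subseteq> {xs. length xs = n \<and> set xs \<subseteq> carrier S}"
  shows "finite (orbit (AutoGroup S) map ` A)"
proof -
  have "finite (orbits (AutoGroup S) {xs. length xs = n \<and> set xs \<subseteq> carrier S} map)"
    using assms(1,2) by (simp add: aleph0_categorical_def)
  moreover have "orbit (AutoGroup S) map ` A
      \<subseteq> orbits (AutoGroup S) {xs. length xs = n \<and> set xs \<subseteq> carrier S} map"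
    using assms(3) by (auto simp: orbits_def)
  ultimately show ?thesis
    by (rule rev_finite_subset)
qed

lemma aleph0_categorical_periodic:
  assumes "aleph0_categorical S"
  shows "periodic S"
  unfolding periodic_def
proof
  fix x assume x: "x \<in> carrier S"
  interpret sgrp S
    using assms by unfold_locales (simp add: aleph0_categorical_def)
  let ?o = "\<lambda>n. orbit (AutoGroup S) map [x, spow S x n]"
  have "finite (orbit (AutoGroup S) map ` range (\<lambda>n. [x, spow S x n]))"
    using x by (intro aleph0_categorical_finite_orbits[OF assms, of 2]) auto
  then have "finite (range ?o)"
    by (simp add: image_image)
  then have "\<not> inj ?o"
    using finite_imageD infinite_UNIV_nat by blast
  then obtain m n where "m < n" "?o m = ?o n"
    unfolding inj_def by (metis linorder_neqE_nat)
  \<comment> \<open>Both pairs start with \<open>x\<close>, so the automorphism fixes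
    \<open>x\<close> and hence all its powers; conjugate powers are therefore equal.\<close>
  moreover have "spow S x m = spow S x n" if "?o m = ?o n" for m n
  proof -
    obtain \<phi> where \<phi>: "\<phi> \<in> auto S" "map \<phi> [x, spow S x m] = [x, spow S x n]"
      using same_orbit[of "[x, spow S x n]" "[x, spow S x m]"] x \<open>?o m = ?o n\<close> by auto
    have "\<phi> (spow S y k) = spow S (\<phi> y) k" if "y \<in> carrier S" for y k
      using that \<phi>(1) by (induction k) (auto simp: auto_def hom_def)
    then show ?thesis
      using \<phi>(2) x by force
  qed
  ultimately show "\<exists>m n. m < n \<and> spow S x m = spow S x n"
    by blast
qed

section \<open>Principal factors of \<open>\<aleph>\<^sub>0\<close>-categorical semigroups\<close>

lemma (in sgrp) aleph0_categorical_principal_factor: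
  assumes cat: "aleph0_categorical S" and a: "a \<in> carrier S"
  shows "aleph0_categorical (principal_factor S a)"
  unfolding aleph0_categorical_def
proof (intro conjI allI impI)
  let ?P = "principal_factor S a"
  interpret P: sgrp ?P
    by unfold_locales (rule is_semigroup_principal_factor[OF a])
  show "is_semigroup ?P"
    by (rule P.sg)
  have "countable (J_ideal S a)"
    using cat J_ideal_carrier[OF a] countable_subset[of "J_ideal S a" "carrier S"]
    by (auto simp: aleph0_categorical_def)
  then show "countable (carrier ?P)"
    by (simp add: principal_factor_carrier)
  fix n :: nat assume "n \<ge> 1"
  let ?E = "{Xs. length Xs = n \<and> set Xs \<subseteq> carrier ?P}"
  \<comment> \<open>Chosen representatives lift a tuple of classes to a tuple in
    \<open>S\<close>.\<close>
  define rep where "rep = inv_into (J_ideal S a) (factor_class S a)"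
  have rep: "rep X \<in> J_ideal S a" "factor_class S a (rep X) = X" if "X \<in> carrier ?P" for X
    using that unfolding rep_def principal_factor_carrier
    by (rule inv_into_into, rule f_inv_into_f)
  \<comment> \<open>Prefixing \<open>a\<close> forces an automorphism that matches two such tuples
    to fix \<open>a\<close>, hence to act on the principal factor. The lifted tuples have length
    \<open>Suc n\<close>.\<close>
  let ?h = "\<lambda>Xs. orbit (AutoGroup S) map (a # map rep Xs)"
  have "finite (orbit (AutoGroup S) map ` (\<lambda>Xs. a # map rep Xs) ` ?E)"
    using a rep(1) J_ideal_carrier[OF a]
    by (intro aleph0_categorical_finite_orbits[OF cat, of "Suc n"]) (auto simp: subset_iff)
  then have fin: "finite (?h ` ?E)"
    by (simp add: image_image)
  have sub: "orbit (AutoGroup ?P) map Ys \<subseteq> orbit (AutoGroup ?P) map Xs"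
    if XY: "Xs \<in> ?E" "Ys \<in> ?E" "?h Xs = ?h Ys" for Xs Ys
  proof -
    have "set (a # map rep Ys) \<subseteq> carrier S"
      using a XY rep(1) J_ideal_carrier[OF a] by auto
    from same_orbit[OF this XY(3)]
    obtain \<phi> where \<phi>: "\<phi> \<in> auto S" "map \<phi> (a # map rep Xs) = a # map rep Ys"
      by (elim bexE)
    then have \<phi>a: "\<phi> a = a" and \<phi>X: "map \<phi> (map rep Xs) = map rep Ys"
      by auto
    \<comment> \<open>The restriction makes the induced map extensional, as \<open>auto\<close>
      demands.\<close>
    define \<psi> where "\<psi> = restrict (\<lambda>X. \<phi> ` X) (carrier ?P)"
    have iso: "(\<lambda>X. \<phi> ` X) \<in> iso ?P ?P"
      using principal_factor_iso[OF auto_iso[OF \<phi>(1)] a] \<phi>a by simp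
    then have \<psi>: "\<psi> \<in> auto ?P"
      unfolding auto_def Bij_def iso_def hom_def \<psi>_def by (auto simp: bij_betw_def inj_on_def)
    have cls: "\<psi> (factor_class S a x) = factor_class S a (\<phi> x)" if x: "x \<in> J_ideal S a" for x
    proof -
      have "\<psi> (factor_class S a x) = \<phi> ` factor_class S a x"
        using x by (simp add: \<psi>_def principal_factor_carrier)
      also have "\<dots> = factor_class S a (\<phi> x)"
        using factor_class_image[OF auto_iso[OF \<phi>(1)] a x] \<phi>a by simp
      finally show ?thesis .
    qed
    have "map \<psi> Xs = map (\<lambda>X. \<psi> (factor_class S a (rep X))) Xs"
      using XY(1) rep(2) by (auto simp: subset_iff)
    also have "\<dots> = map (factor_class S a) (map \<phi> (map rep Xs))"
      using XY(1) rep(1) cls by (auto simp: subset_iff)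
    also have "\<dots> = map (factor_class S a) (map rep Ys)"
      by (simp only: \<phi>X)
    also have "\<dots> = Ys"
      using XY(2) rep(2) by (auto simp: subset_iff intro: map_idI)
    finally show ?thesis
      using P.orbit_map_subset[OF \<psi>, of Xs] XY(1) by simp
  qed
  have "finite (orbit (AutoGroup ?P) map ` ?E)"
    by (rule finite_image_coarser[OF fin]) (use sub in blast)
  then show "finite (orbits (AutoGroup ?P) ?E map)"
    unfolding orbits_def Setcompr_eq_image .
qed

text \<open>If all products of elements of J(a) fall into I(a), the factor is null. Otherwise one
  surviving product makes it simple or 0-simple by \<open>J_class_product_sandwich\<close>, and
  periodicity provides the primitive idempotent.\<close>

lemma (in sgrp) principal_factor_cases:
  assumes a: "a \<in> carrier S" and per: "periodic (principal_factor S a)"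
  shows "completely_0_simple (principal_factor S a) \<or> completely_simple (principal_factor S a)
    \<or> null_semigroup (principal_factor S a)"
proof -
  let ?P = "principal_factor S a" and ?J = "J_ideal S a" and ?I = "I_set S a"
    and ?c = "factor_class S a"
  interpret P: sgrp ?P
    by unfold_locales (rule is_semigroup_principal_factor[OF a])
  have J: "x \<otimes> y \<in> ?J" if "x \<in> ?J" "y \<in> ?J" for x y
    using that sg_ideal_J_ideal[OF a] J_ideal_carrier[OF a] by (auto simp: sg_ideal_def)
  have IJ: "?I \<subseteq> ?J"
    by (auto simp: I_set_def)
  have I: "x \<otimes> y \<in> ?I \<and> y \<otimes> x \<in> ?I" if "x \<in> ?I" "y \<in> ?J" for x y
    using that I_set_absorbs[OF a] J_ideal_carrier[OF a] by blast
  \<comment> \<open>\<open>Z\<close> is empty or contains just the zero, so the simple and the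
    0-simple case can be argued together.\<close>
  define Z where "Z = ?c ` ?I"
  have a_notin: "a \<notin> ?I"
    using a self_in_J_ideal by (simp add: I_set_iff)
  have c_Z: "?c x \<in> Z \<longleftrightarrow> x \<in> ?I" if "x \<in> ?J" for x
    using that IJ factor_class_eq_iff[of x a] by (auto simp: Z_def)
  have Z_absorbs: "s \<otimes>\<^bsub>?P\<^esub> z \<in> Z \<and> z \<otimes>\<^bsub>?P\<^esub> s \<in> Z" if "z \<in> Z" "s \<in> carrier ?P" for z s
  proof -
    obtain i x where "i \<in> ?I" "z = ?c i" "x \<in> ?J" "s = ?c x"
      using \<open>z \<in> Z\<close> \<open>s \<in> carrier ?P\<close> unfolding Z_def principal_factor_carrier by blast
    then show ?thesis
      using I[of i x] IJ J[of i x] J[of x i]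
      by (auto simp: principal_factor_mult[OF a] c_Z subset_iff)
  qed
  have zero: "is_zero ?P (?c i)" "Z = {?c i}" if "i \<in> ?I" for i
  proof -
    show Zi: "Z = {?c i}"
      using that IJ factor_class_eq_iff[of _ a i] unfolding Z_def by blast
    show "is_zero ?P (?c i)"
      using Z_absorbs that IJ unfolding is_zero_def Zi by (auto simp: principal_factor_carrier)
  qed
  show ?thesis
  proof (cases "\<exists>b\<in>?J. \<exists>c\<in>?J. b \<otimes> c \<notin> ?I")
    case False
    \<comment> \<open>This element shows that I(a) is nonempty, so its class serves as the
      zero.\<close>
    then have "a \<otimes> a \<in> ?I"
      using self_in_J_ideal by blast
    note z = zero[OF this]
    have "X \<otimes>\<^bsub>?P\<^esub> Y = ?c (a \<otimes> a)" if XY: "X \<in> carrier ?P" "Y \<in> carrier ?P" for X Y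
    proof -
      obtain x y where "x \<in> ?J" "X = ?c x" "y \<in> ?J" "Y = ?c y"
        using XY unfolding principal_factor_carrier by blast
      then have "X \<otimes>\<^bsub>?P\<^esub> Y \<in> Z"
        using False J by (simp add: principal_factor_mult[OF a] c_Z)
      then show ?thesis
        using z(2) by blast
    qed
    then have "null_semigroup ?P"
      unfolding null_semigroup_def using P.sg z(1) by blast
    then show ?thesis
      by blast
  next
    case True
    then obtain b c where bc: "b \<in> ?J" "c \<in> ?J" "b \<otimes> c \<notin> ?I"
      by blast
    have simple: "\<exists>p\<in>carrier ?P. \<exists>q\<in>carrier ?P. y = p \<otimes>\<^bsub>?P\<^esub> x \<otimes>\<^bsub>?P\<^esub> q"
      if xy: "x \<in> carrier ?P - Z" "y \<in> carrier ?P" for x y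
    proof -
      obtain u v where uv: "x = ?c u" "u \<in> ?J" "y = ?c v" "v \<in> ?J" "u \<notin> ?I"
        using xy c_Z unfolding principal_factor_carrier by blast
      then obtain p q where pq: "p \<in> ?J" "q \<in> ?J" "v = p \<otimes> u \<otimes> q"
        using J_class_product_sandwich[OF a bc] by blast
      then have "y = ?c p \<otimes>\<^bsub>?P\<^esub> x \<otimes>\<^bsub>?P\<^esub> ?c q"
        using uv by (simp add: principal_factor_mult[OF a] J)
      then show ?thesis
        using pq by (auto simp: principal_factor_carrier)
    qed
    have "?c a \<in> carrier ?P - Z"
      using a_notin self_in_J_ideal by (simp add: c_Z principal_factor_carrier)
    then have "carrier ?P - Z \<noteq> {}"
      by blast
    from P.primitive_idempotent[OF per this Z_absorbs simple]
    obtain e where e: "e \<in> idempotents ?P" "e \<notin> Z"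
        "\<And>f. f \<in> idempotents ?P \<Longrightarrow> idem_le ?P f e \<Longrightarrow> f \<in> Z \<or> f = e"
      by blast
    \<comment> \<open>By \<open>simple\<close>, the two-sided multiples of one element outside
      \<open>Z\<close> exhaust the factor.\<close>
    have ideal: "L = carrier ?P" if L: "sg_ideal ?P L" "\<not> L \<subseteq> Z" for L
    proof
      show "L \<subseteq> carrier ?P"
        using L(1) by (simp add: sg_ideal_def)
      with L(2) obtain x where x: "x \<in> L" "x \<in> carrier ?P - Z"
        by blast
      show "carrier ?P \<subseteq> L"
      proof
        fix y assume "y \<in> carrier ?P"
        then obtain p q where "p \<in> carrier ?P" "q \<in> carrier ?P" "y = p \<otimes>\<^bsub>?P\<^esub> x \<otimes>\<^bsub>?P\<^esub> q"
          using simple[OF x(2)] by blast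
        then show "y \<in> L"
          using L(1) x(1) unfolding sg_ideal_def by simp
      qed
    qed
    show ?thesis
    proof (cases "?I = {}")
      case True
      then have "Z = {}"
        by (simp add: Z_def)
      then have "L = carrier ?P" if "sg_ideal ?P L" for L
        using ideal[OF that] that by (simp add: sg_ideal_def)
      then have "completely_simple ?P"
        unfolding completely_simple_def using P.sg e(3) \<open>Z = {}\<close>
        by (auto intro: bexI[OF _ e(1)])
      then show ?thesis
        by blast
    next
      case False
      then obtain i where i: "i \<in> ?I"
        by blast
      note Zi = zero(2)[OF i]
      have "L = {?c i} \<or> L = carrier ?P" if "sg_ideal ?P L" for L
      proof (cases "L \<subseteq> Z")
        case True
        then show ?thesis
          using that unfolding Zi sg_ideal_def by blast
      qed (use ideal[OF that] in blast)
      \<comment> \<open>The surviving product shows that the multiplication is not null.\<close>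
      moreover have "?c b \<otimes>\<^bsub>?P\<^esub> ?c c \<noteq> ?c i"
      proof -
        have "?c b \<otimes>\<^bsub>?P\<^esub> ?c c \<notin> Z"
          using bc J by (simp add: principal_factor_mult[OF a] c_Z)
        then show ?thesis
          using Zi by blast
      qed
      moreover have "?c b \<in> carrier ?P" "?c c \<in> carrier ?P"
        using bc unfolding principal_factor_carrier by blast+
      moreover have "e \<noteq> ?c i" "\<forall>f\<in>idempotents ?P. idem_le ?P f e \<longrightarrow> f = ?c i \<or> f = e"
        using e(2,3) unfolding Zi by blast+
      ultimately have "completely_0_simple ?P"
        unfolding completely_0_simple_def
        by (intro conjI P.sg exI[of _ "?c i"] zero(1)[OF i] bexI[of _ "?c b"] bexI[of _ "?c c"]
            bexI[OF _ e(1)] allI impI)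
      then show ?thesis
        by blast
    qed
  qed
qed

text \<open>Both kinds of principal factors become indexed by elements of \<open>S\<close>, the
  kernel by any of its own elements.\<close>

lemma (in sgrp) principal_factors_subset:
  "principal_factors S \<subseteq> principal_factor S ` carrier S"
proof
  fix P assume "P \<in> principal_factors S"
  then consider a where "a \<in> carrier S" "P = principal_factor S a"
    | K where "sg_kernel S K" "P = rees_quotient (S\<lparr>carrier := K\<rparr>) {}"
    unfolding principal_factors_def by blast
  then show "P \<in> principal_factor S ` carrier S"
  proof cases
    case (2 K)
    then obtain k where "k \<in> K" "k \<in> carrier S"
      by (auto simp: sg_kernel_def sg_ideal_def)
    then show ?thesis
      using 2 sg_kernel_eq_J_ideal[of K k] by (intro image_eqI[of _ _ k]) simp_all
  qed blast
qed

section \<open>Finiteness up to isomorphism\<close>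

lemma (in sgrp) finite_iso_classes_principal_factors:
  assumes "aleph0_categorical S"
  shows "finite (iso_classes (principal_factors S))"
proof -
  let ?F = "principal_factors S"
  let ?r = "{(P, Q). P \<in> ?F \<and> Q \<in> ?F \<and> P \<cong> Q}"
  \<comment> \<open>Keeping only elements whose factor belongs to the family makes the isomorphism
    classes exactly the images of \<open>?A\<close>.\<close>
  let ?A = "{a \<in> carrier S. principal_factor S a \<in> ?F}"
  let ?h = "\<lambda>a. orbit (AutoGroup S) map [a]"
  have "finite (orbit (AutoGroup S) map ` (\<lambda>a. [a]) ` ?A)"
    by (intro aleph0_categorical_finite_orbits[OF assms, of 1]) auto
  then have fin: "finite (?h ` ?A)"
    by (simp add: image_image)
  have iso: "principal_factor S a \<cong> principal_factor S b"
    if ab: "a \<in> ?A" "b \<in> ?A" "?h a = ?h b" for a b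
  proof -
    obtain \<phi> where "\<phi> \<in> auto S" "map \<phi> [a] = [b]"
      using same_orbit[of "[b]" "[a]"] ab by auto
    then show ?thesis
      using principal_factor_iso[OF auto_iso, of \<phi> a] ab by (auto intro: is_isoI)
  qed
  have "finite ((\<lambda>a. ?r `` {principal_factor S a}) ` ?A)"
  proof (rule finite_image_coarser[OF fin])
    fix a b assume ab: "a \<in> ?A" "b \<in> ?A" "?h a = ?h b"
    \<comment> \<open>Exchanging \<open>a\<close> and \<open>b\<close> supplies the isomorphism in
      the other direction.\<close>
    show "?r `` {principal_factor S a} = ?r `` {principal_factor S b}"
      using iso[OF ab] iso[OF ab(2,1) ab(3)[symmetric]] ab(1,2) by (auto intro: iso_trans)
  qed
  moreover have "iso_classes ?F = (\<lambda>a. ?r `` {principal_factor S a}) ` ?A"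
    using principal_factors_subset by (auto simp: iso_classes_def quotient_def)
  ultimately show ?thesis
    by simp
qed

theorem theorem4p1:
  fixes S :: "('a, 'b) monoid_scheme"
  assumes "aleph0_categorical S"
  shows "(\<forall>P\<in>principal_factors S.
            aleph0_categorical P \<and>
            (completely_0_simple P \<or> completely_simple P \<or> null_semigroup P))
         \<and> finite (iso_classes (principal_factors S))"
proof -
  interpret sgrp S
    using assms by unfold_locales (simp add: aleph0_categorical_def)
  show ?thesis
  proof (intro conjI ballI)
    fix P assume "P \<in> principal_factors S"
    then obtain a where a: "a \<in> carrier S" "P = principal_factor S a"
      using principal_factors_subset by blast
    then show cat: "aleph0_categorical P"
      using aleph0_categorical_principal_factor[OF assms] by simp
    \<comment> \<open>Periodicity of \<open>P\<close> is drawn from the categoricity of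
      \<open>P\<close> just shown.\<close>
    show "completely_0_simple P \<or> completely_simple P \<or> null_semigroup P"
      using principal_factor_cases[OF a(1)] aleph0_categorical_periodic[OF cat] a(2) by simp
  qed (rule finite_iso_classes_principal_factors[OF assms])
qed

end
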